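(* For every positive integer $d$ there exists a positive integer $m$ such that every sequence $(a_1,\dotsc,a_m)$ of $m$ distinct real numbers contains a monotone subsequence whose index set is a proper affine $d$-cube; that is, there is a proper affine $d$-cube $S\subseteq[m]$ such that the subsequence $(a_i)_{i\in S}$ (taken in increasing order of indices) is monotone.
   Context: An affine $d$-cube is a set of integers of the form $\{x_0+\varepsilon_1 x_1+\dotsb+\varepsilon_d x_d : \varepsilon_1,\dotsc,\varepsilon_d\in\{0,1\}\}$ for some integers $x_0,x_1,\dotsc,x_d$. It is proper if it contains $2^d$ distinct elements. $[m]=\{1,\dotsc,m\}$. *)

theory Defs
  imports Complex_Main
begin

definition affine_cube :: "nat \<Rightarrow> int set \<Rightarrow> bool" where
  "affine_cube d S \<longleftrightarrow>
     (\<exists>x :: nat \<Rightarrow> int.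
        S = {x 0 + (\<Sum>i = 1..d. \<epsilon> i * x i) | \<epsilon>. \<forall>i\<in>{1..d}. \<epsilon> i \<in> {0, 1}})"

definition proper_affine_cube :: "nat \<Rightarrow> int set \<Rightarrow> bool" where
  "proper_affine_cube d S \<longleftrightarrow> affine_cube d S \<and> card S = 2 ^ d"

end

theory Submission
  imports Defs "HOL-Library.Ramsey" "HOL-Library.Disjoint_Sets"
begin

text \<open>
  Numbers of the form \<open>\<Sum>i<n. 2 ^ h (6 * i + x i)\<close> with digits \<open>x i < 6\<close> are ordered
  lexicographically by \<open>x\<close>, the last coordinate being the most significant. By Ramsey's theorem for
  \<open>2n\<close>-element sets, \<open>h\<close> can be chosen such that, for small digits, the comparison of \<open>a\<close> at two of
  these numbers depends only on the signs of the coordinate differences. Among \<open>n = 4d\<close> coordinates, \<open>2d\<close>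
  have the property that increasing one of them alone always moves \<open>a\<close> in the same direction, say
  upwards. Transitivity yields in every set of such coordinates a dominant one, whose increase outweighs
  any change of the others. A direction of the cube increases two coordinates at
  once, namely the most significant and the dominant one; removing both and
  repeating gives \<open>d\<close> directions for which indices and values are both ordered lexicographically.
\<close>

section \<open>Ramsey's theorem for increasing enumerations\<close>

text \<open>Colour an \<open>r\<close>-element set by \<open>F\<close> of its increasing list. If
  \<open>h\<close> enumerates a homogeneous set, then \<open>h \<circ> e\<close> lists an
  \<open>r\<close>-element subset of it. \<open>N\<close> is fixed before \<open>F\<close>, because
  \<open>F\<close> will depend on the sequence.\<close>

lemma ramsey_enumeration:
  fixes C :: "'c set" and K r :: nat
  assumes "finite C"
  shows "\<exists>N. \<forall>F. range F \<subseteq> C \<longrightarrow>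
    (\<exists>h c. strict_mono_on {..<K} h \<and> h ` {..<K} \<subseteq> {..<N::nat} \<and>
      (\<forall>e. strict_mono_on {..<r} e \<and> e ` {..<r} \<subseteq> {..<K} \<longrightarrow> F (map (h \<circ> e) [0..<r]) = c))"
proof -
  obtain N where N: "partn_lst {..<N::nat} (replicate (card C) K) r"
    using ramsey_full by blast
  \<comment> \<open>\<open>partn_lst\<close> numbers its colours, so the elements of
    \<open>C\<close> are coded as numbers below \<open>card C\<close>.\<close>
  obtain b where b: "bij_betw b C {..<card C}"
    using ex_bij_betw_finite_nat[OF assms] by (auto simp: atLeast0LessThan)
  have "\<exists>h c. strict_mono_on {..<K} h \<and> h ` {..<K} \<subseteq> {..<N} \<and>
      (\<forall>e. strict_mono_on {..<r} e \<and> e ` {..<r} \<subseteq> {..<K} \<longrightarrow> F (map (h \<circ> e) [0..<r]) = c)"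
    if F: "range F \<subseteq> C" for F
  proof -
    define f where "f = (\<lambda>Y. b (F (sorted_list_of_set Y)))"
    have "f \<in> nsets {..<N} r \<rightarrow> {..<length (replicate (card C) K)}"
      using F b by (auto simp: f_def bij_betw_def)
    then obtain i H where i: "i < card C" and H: "H \<in> nsets {..<N} K"
      and mono: "f ` nsets H r \<subseteq> {i}"
      using N by (force simp: partn_lst_def monochromatic_def)
    have finH: "finite H" and cardH: "card H = K" and HN: "H \<subseteq> {..<N}"
      using H by (auto simp: nsets_def)
    define h where "h = (!) (sorted_list_of_set H)"
    have h: "strict_mono_on {..<K} h"
      unfolding h_def using cardH sorted_wrt_nth_less[OF strict_sorted_list_of_set[of H]]
      by (auto simp: strict_mono_on_def)
    have img: "h ` {..<K} = H"
      using cardH finH by (metis h_def length_sorted_list_of_set lessThan_atLeast0 list.set_map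
          map_nth set_sorted_list_of_set set_upt)
    have "F (map (h \<circ> e) [0..<r]) = inv_into C b i"
      if e: "strict_mono_on {..<r} e" "e ` {..<r} \<subseteq> {..<K}" for e
    proof -
      have he: "strict_mono_on {..<r} (h \<circ> e)"
        using h e by (fastforce simp: strict_mono_on_def image_subset_iff)
      let ?Y = "(h \<circ> e) ` {..<r}"
      have "card ?Y = r"
        using card_image[OF strict_mono_on_imp_inj_on[OF he]] by simp
      moreover have "?Y \<subseteq> H"
        using e img by auto
      ultimately have "?Y \<in> nsets H r"
        by (simp add: nsets_def)
      then have "f ?Y = i"
        using mono by blast
      moreover have "sorted_list_of_set ?Y = map (h \<circ> e) [0..<r]"
      proof (rule strict_sorted_equal)
        show "sorted_wrt (<) (map (h \<circ> e) [0..<r])"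
          using he by (auto simp: sorted_wrt_map sorted_wrt_iff_nth_less strict_mono_on_def)
      qed (auto simp: atLeast0LessThan)
      ultimately have "b (F (map (h \<circ> e) [0..<r])) = i"
        by (simp add: f_def)
      then show ?thesis
        using F b by (metis bij_betw_inv_into_left rangeI subsetD)
    qed
    then show ?thesis
      using h img HN by blast
  qed
  then show ?thesis by blast
qed

section \<open>Grid points and their lexicographic order\<close>

text \<open>Coordinate \<open>i\<close> owns the \<open>w\<close> positions from
  \<open>w * i\<close> on, so for increasing \<open>h\<close> later coordinates carry higher powers.
  Changing one digit shifts the sum by an amount independent of the other digits; this is what
  yields affine cubes.\<close>

definition grid_point :: "nat \<Rightarrow> nat \<Rightarrow> (nat \<Rightarrow> nat) \<Rightarrow> (nat \<Rightarrow> nat) \<Rightarrow> nat" where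
  "grid_point w n h x = (\<Sum>i<n. 2 ^ h (w * i + x i))"

lemma sum_power2_less:
  fixes e :: "nat \<Rightarrow> nat"
  assumes "\<And>i. i < t \<Longrightarrow> e i < e (Suc i)"
  shows "(\<Sum>i\<le>t. 2 ^ e i) < (2::nat) ^ Suc (e t)"
  using assms
proof (induction t)
  case (Suc t)
  have "(\<Sum>i\<le>t. 2 ^ e i) < (2::nat) ^ Suc (e t)"
    using Suc by simp
  also have "\<dots> \<le> 2 ^ e (Suc t)"
    using Suc.prems[of t] by (intro power_increasing) auto
  finally show ?case by simp
qed simp

lemma block_less:
  fixes w i j a b :: nat
  assumes "i < j" "a < w"
  shows "w * i + a < w * j + b"
proof -
  have "w * i + a < w * Suc i" using assms by simp
  also have "\<dots> \<le> w * j" using assms by (intro mult_le_mono2) simp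
  finally show ?thesis by simp
qed

text \<open>The powers of \<open>x\<close> up to coordinate \<open>t\<close> have increasing
  exponents, so their sum is less than twice the last one, hence less than the single power of
  \<open>y\<close> at \<open>t\<close>.\<close>

lemma grid_point_less:
  fixes x y :: "nat \<Rightarrow> nat" and t :: nat
  assumes h: "strict_mono_on {..<w * n} h"
    and x: "\<And>i. i < n \<Longrightarrow> x i < w" and y: "\<And>i. i < n \<Longrightarrow> y i < w"
    and t: "t < n" "x t < y t" and eq: "\<And>i. t < i \<Longrightarrow> i < n \<Longrightarrow> x i = y i"
  shows "grid_point w n h x < grid_point w n h y"
proof -
  have bd: "w * i + z < w * n" if "i < n" "z < w" for i z
    using block_less[of i n z w 0] that by simp
  have split: "{..<n} = {..t} \<union> {t<..<n}"
    using t by auto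
  have "(\<Sum>i\<le>t. 2 ^ h (w * i + x i)) < (2::nat) ^ Suc (h (w * t + x t))"
  proof (rule sum_power2_less)
    fix i assume "i < t"
    then show "h (w * i + x i) < h (w * Suc i + x (Suc i))"
      using t x by (intro strict_mono_onD[OF h] block_less) (auto intro!: bd simp del: mult_Suc_right)
  qed
  also have "\<dots> \<le> 2 ^ h (w * t + y t)"
  proof (intro power_increasing)
    show "Suc (h (w * t + x t)) \<le> h (w * t + y t)"
      unfolding Suc_le_eq using t x y by (intro strict_mono_onD[OF h]) (auto intro!: bd)
  qed simp
  also have "\<dots> \<le> (\<Sum>i\<le>t. 2 ^ h (w * i + y i))"
    by (rule member_le_sum) auto
  finally have "(\<Sum>i\<le>t. 2 ^ h (w * i + x i)) < (\<Sum>i\<le>t. (2::nat) ^ h (w * i + y i))" .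
  moreover have "(\<Sum>i\<in>{t<..<n}. 2 ^ h (w * i + x i)) = (\<Sum>i\<in>{t<..<n}. (2::nat) ^ h (w * i + y i))"
    using eq by (intro sum.cong) auto
  moreover have "grid_point w n h z =
      (\<Sum>i\<le>t. 2 ^ h (w * i + z i)) + (\<Sum>i\<in>{t<..<n}. 2 ^ h (w * i + z i))" for z
    unfolding grid_point_def split by (rule sum.union_disjoint) auto
  ultimately show ?thesis by simp
qed

lemma grid_point_inj:
  assumes h: "strict_mono_on {..<w * n} h"
    and x: "\<And>i. i < n \<Longrightarrow> x i < w" and y: "\<And>i. i < n \<Longrightarrow> y i < w"
    and neq: "\<exists>i<n. x i \<noteq> y i"
  shows "grid_point w n h x \<noteq> grid_point w n h y"
proof -
  let ?A = "{i. i < n \<and> x i \<noteq> y i}"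
  define t where "t = Max ?A"
  have fin: "finite ?A" by simp
  have "t \<in> ?A" unfolding t_def using neq fin by (intro Max_in) auto
  moreover have "x i = y i" if "t < i" "i < n" for i
    using Max_ge[OF fin, of i] that by (fastforce simp: t_def)
  moreover have "x t < y t \<or> y t < x t"
    using calculation(1) by auto
  ultimately have "grid_point w n h x < grid_point w n h y \<or> grid_point w n h y < grid_point w n h x"
    using grid_point_less[of w n h x y t] grid_point_less[of w n h y x t] h x y by auto
  then show ?thesis by auto
qed

section \<open>Sign patterns and dominant coordinates\<close>

text \<open>\<open>Pos L G\<close> says that the value rises whenever the coordinates in \<open>L\<close> decrease, those in
  \<open>G\<close> increase, and the others stay fixed. The last axiom is transitivity: a coordinate that moves
  in opposite directions in the two steps may have any net movement.\<close>

locale sign_cone =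
  fixes n :: nat and Pos :: "nat set \<Rightarrow> nat set \<Rightarrow> bool"
  assumes total: "\<lbrakk>L \<subseteq> {..<n}; G \<subseteq> {..<n}; L \<inter> G = {}; L \<union> G \<noteq> {}\<rbrakk> \<Longrightarrow> Pos L G \<or> Pos G L"
    and compose: "\<lbrakk>Pos L G; Pos L' G'; L \<inter> G = {}; L' \<inter> G' = {}; L'' \<inter> G'' = {};
      L \<union> G \<union> L' \<union> G' \<subseteq> {..<n};
      L'' \<subseteq> L \<union> L'; G'' \<subseteq> G \<union> G'; L - G' \<subseteq> L''; L' - G \<subseteq> L''; G - L' \<subseteq> G''; G' - L \<subseteq> G''\<rbrakk>
      \<Longrightarrow> Pos L'' G''"
begin

text \<open>Corresponds to reversing the order of the values; it reduces the decreasing case to the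
  increasing one.\<close>

lemma dual: "sign_cone n (\<lambda>L G. Pos G L)"
proof
  show "Pos G'' L''" if "Pos G L" "Pos G' L'" "L \<inter> G = {}" "L' \<inter> G' = {}" "L'' \<inter> G'' = {}"
      "L \<union> G \<union> L' \<union> G' \<subseteq> {..<n}" "L'' \<subseteq> L \<union> L'" "G'' \<subseteq> G \<union> G'" "L - G' \<subseteq> L''" "L' - G \<subseteq> L''"
      "G - L' \<subseteq> G''" "G' - L \<subseteq> G''" for L G L' G' L'' G''
    by (rule compose[OF that(1,2)]) (use that in blast)+
  show "Pos G L \<or> Pos L G" if "L \<subseteq> {..<n}" "G \<subseteq> {..<n}" "L \<inter> G = {}" "L \<union> G \<noteq> {}" for L G
    using total[OF that] by blast
qed

lemma Pos_empty:
  assumes "finite R" "R \<noteq> {}" "R \<subseteq> {..<n}" "\<And>i. i \<in> R \<Longrightarrow> Pos {} {i}"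
  shows "Pos {} R"
  using assms
proof (induction R rule: finite_ne_induct)
  case (insert k R)
  show ?case
    by (rule compose[of "{}" R "{}" "{k}"]) (use insert in auto)
qed auto

text \<open>The dominant \<open>i\<close> of \<open>R\<close> is compared with the new coordinate
  \<open>k\<close>. If raising \<open>k\<close> outweighs lowering \<open>i\<close>, this step is
  followed by \<open>Pos (R - {i}) {i}\<close>; the net movement of \<open>i\<close> is then free
  and is chosen downwards, so \<open>k\<close> dominates.\<close>

lemma ex_dominant:
  assumes "finite R" "R \<noteq> {}" "R \<subseteq> {..<n}" "\<And>i. i \<in> R \<Longrightarrow> Pos {} {i}"
  shows "\<exists>i\<in>R. Pos (R - {i}) {i}"
  using assms
proof (induction R rule: finite_ne_induct)
  case (insert k R)
  then obtain i where i: "i \<in> R" "Pos (R - {i}) {i}" by auto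
  have "Pos {i} {k} \<or> Pos {k} {i}"
    using i insert by (intro total) auto
  then show ?case
  proof
    assume "Pos {i} {k}"
    then have "Pos R {k}"
      by (rule compose[OF _ i(2)]) (use i insert in auto)
    then show ?thesis using insert by simp
  next
    assume "Pos {k} {i}"
    then have "Pos (insert k R - {i}) {i}"
      by (rule compose[OF _ i(2)]) (use i insert in auto)
    then show ?thesis using i by blast
  qed
qed simp

text \<open>Let all coordinates of \<open>R\<close> except \<open>i\<close> first drop and then
  rise: their net movements are free, while \<open>i\<close> rises twice.\<close>

lemma Pos_dominant:
  assumes R: "finite R" "R \<subseteq> {..<n}" "\<And>i. i \<in> R \<Longrightarrow> Pos {} {i}"
    and i: "i \<in> G" "Pos (R - {i}) {i}" and LG: "L \<inter> G = {}" "L \<union> G \<subseteq> R"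
  shows "Pos L G"
proof -
  have "R \<noteq> {}" using i LG by blast
  then have "Pos {} R" by (rule Pos_empty[OF R(1) _ R(2,3)])
  with i(2) show ?thesis
    by (rule compose) (use R i(1) LG in blast)+
qed

text \<open>Each block consists of the last remaining coordinate, which decides the order of the indices,
  and of the dominant remaining coordinate, which decides the order of the values.\<close>

lemma ex_blocks:
  assumes "finite E" "E \<subseteq> {..<n}" "\<And>i. i \<in> E \<Longrightarrow> Pos {} {i}" "2 * d \<le> card E"
  shows "\<exists>B :: nat \<Rightarrow> nat set. (\<forall>j\<in>{1..d}. B j \<subseteq> E) \<and> disjoint_family_on B {1..d} \<and>
    (\<forall>j\<in>{1..d}. \<exists>t\<in>B j. \<forall>k\<in>{1..j}. \<forall>s\<in>B k. s \<le> t) \<and>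
    (\<forall>j\<in>{1..d}. \<forall>L G. L \<inter> G = {} \<longrightarrow> B j \<subseteq> G \<longrightarrow> L \<union> G \<subseteq> (\<Union>k\<in>{1..j}. B k) \<longrightarrow> Pos L G)"
  using assms
proof (induction d arbitrary: E)
  case (Suc d)
  have ne: "E \<noteq> {}" using Suc.prems by auto
  obtain i where i: "i \<in> E" "Pos (E - {i}) {i}"
    using ex_dominant[OF Suc.prems(1) ne Suc.prems(2,3)] by blast
  \<comment> \<open>The last and the dominant coordinate may coincide, so only
    \<open>card T \<le> 2\<close> is available.\<close>
  define T where "T = {Max E, i}"
  have T: "T \<subseteq> E" "finite T" "card T \<le> 2"
    using i ne Suc.prems by (auto simp: T_def card_insert_if)
  have "2 * d \<le> card (E - T)"
    using T Suc.prems by (simp add: card_Diff_subset)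
  moreover have "finite (E - T)" "E - T \<subseteq> {..<n}" "\<And>i. i \<in> E - T \<Longrightarrow> Pos {} {i}"
    using Suc.prems by auto
  ultimately obtain B :: "nat \<Rightarrow> nat set" where
      B1: "\<forall>j\<in>{1..d}. B j \<subseteq> E - T"
      and B2: "disjoint_family_on B {1..d}"
      and B3: "\<forall>j\<in>{1..d}. \<exists>t\<in>B j. \<forall>k\<in>{1..j}. \<forall>s\<in>B k. s \<le> t"
      and B4: "\<forall>j\<in>{1..d}. \<forall>L G. L \<inter> G = {} \<longrightarrow> B j \<subseteq> G \<longrightarrow>
        L \<union> G \<subseteq> (\<Union>k\<in>{1..j}. B k) \<longrightarrow> Pos L G"
    using Suc.IH[of "E - T"] by (elim exE conjE meta_impE) simp_all
  \<comment> \<open>The block chosen first outranks the remaining ones in both orders, so it gets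
    the highest index.\<close>
  define B' where "B' = B(Suc d := T)"
  have old: "B' k = B k" if "k \<in> {1..j}" "j \<in> {1..d}" for j k
    using that by (auto simp: B'_def)
  have new: "B' (Suc d) = T" by (simp add: B'_def)
  have sub: "B' j \<subseteq> E" if "j \<in> {1..Suc d}" for j
    using that B1 T by (cases "j = Suc d") (auto simp: B'_def)
  have cases: "j \<in> {1..d} \<or> j = Suc d" if "j \<in> {1..Suc d}" for j
    using that by auto
  show ?case
  proof (intro exI[of _ B'] conjI ballI allI impI)
    show "disjoint_family_on B' {1..Suc d}"
      using B2 B1 by (fastforce simp: disjoint_family_on_def B'_def le_Suc_eq)
    fix j assume j: "j \<in> {1..Suc d}"
    show "B' j \<subseteq> E" using sub j .
    show "\<exists>t\<in>B' j. \<forall>k\<in>{1..j}. \<forall>s\<in>B' k. s \<le> t"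
      using cases[OF j]
    proof
      assume "j \<in> {1..d}"
      then show ?thesis using B3 old[of _ j] by simp
    next
      assume "j = Suc d"
      moreover have "\<forall>k\<in>{1..Suc d}. \<forall>s\<in>B' k. s \<le> Max E"
        using sub Suc.prems(1) by (meson Max_ge subsetD)
      ultimately show ?thesis using new by (auto simp: T_def)
    qed
    fix L G assume LG: "L \<inter> G = {}" "B' j \<subseteq> G" "L \<union> G \<subseteq> (\<Union>k\<in>{1..j}. B' k)"
    show "Pos L G"
      using cases[OF j]
    proof
      assume "j \<in> {1..d}"
      then show ?thesis using B4 old[of _ j] LG by simp
    next
      assume jd: "j = Suc d"
      have "(\<Union>k\<in>{1..j}. B' k) \<subseteq> E" using sub jd by blast
      moreover have "i \<in> G" using LG new jd by (auto simp: T_def)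
      moreover have "L \<union> G \<subseteq> E"
        using LG(3) calculation(1) by (rule subset_trans)
      ultimately show ?thesis
        using Pos_dominant[OF Suc.prems(1-3) _ i(2) LG(1)] by blast
    qed
  qed
qed (simp add: disjoint_family_on_def)

end

section \<open>Affine cubes ordered alike in index and value\<close>

abbreviation ind :: "nat set \<Rightarrow> nat \<Rightarrow> nat" where
  "ind X i \<equiv> of_bool (i \<in> X)"

text \<open>A set \<open>W\<close> of block numbers is sent to the grid point with digit 1 exactly
  on the union of its blocks. For two such sets the largest block number in which they differ
  decides both comparisons. \<open>R\<close> stays abstract to serve increasing and decreasing
  values alike.\<close>

lemma (in sign_cone) ex_ordered_cube:
  assumes h: "strict_mono_on {..<w * n} h" and w: "1 < w"
    and R: "\<And>X Y. \<lbrakk>X \<subseteq> {..<n}; Y \<subseteq> {..<n}; Pos (X - Y) (Y - X)\<rbrakk>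
      \<Longrightarrow> R (grid_point w n h (ind X)) (grid_point w n h (ind Y))"
    and E: "E \<subseteq> {..<n}" "\<And>i. i \<in> E \<Longrightarrow> Pos {} {i}" "2 * d \<le> card E"
  shows "\<exists>S. S \<subseteq> (\<lambda>X. grid_point w n h (ind X)) ` Pow {..<n} \<and> proper_affine_cube d (int ` S) \<and>
    (\<forall>s\<in>S. \<forall>s'\<in>S. s < s' \<longrightarrow> R s s')"
proof -
  have "finite E" using E finite_subset by blast
  then obtain B :: "nat \<Rightarrow> nat set" where
      B1: "\<forall>j\<in>{1..d}. B j \<subseteq> E"
      and B2: "disjoint_family_on B {1..d}"
      and B3: "\<forall>j\<in>{1..d}. \<exists>t\<in>B j. \<forall>k\<in>{1..j}. \<forall>s\<in>B k. s \<le> t"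
      and B4: "\<forall>j\<in>{1..d}. \<forall>L G. L \<inter> G = {} \<longrightarrow> B j \<subseteq> G \<longrightarrow>
        L \<union> G \<subseteq> (\<Union>k\<in>{1..j}. B k) \<longrightarrow> Pos L G"
    using ex_blocks[of E d] E by (elim exE conjE meta_impE) simp_all
  define q where "q = (\<lambda>X. grid_point w n h (ind X))"
  define u where "u = (\<lambda>W. \<Union>k\<in>W. B k)"
  have Bn: "B j \<subseteq> {..<n}" if "j \<in> {1..d}" for j
    using B1 E that by blast
  have un: "u W \<subseteq> {..<n}" if "W \<subseteq> {1..d}" for W
    using Bn that by (fastforce simp: u_def)
  have dis: "k = j" if "i \<in> B k" "i \<in> B j" "k \<in> {1..d}" "j \<in> {1..d}" for i j k
    using B2 that by (fastforce simp: disjoint_family_on_def)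
  have less: "q (u W) < q (u W') \<and> R (q (u W)) (q (u W'))"
    if W: "W \<subseteq> {1..d}" "W' \<subseteq> {1..d}" and j: "j \<in> W'" "j \<notin> W"
      and top: "\<And>k. j < k \<Longrightarrow> k \<in> W \<longleftrightarrow> k \<in> W'" for W W' j
  proof
    have jd: "j \<in> {1..d}" using W j by blast
    have diff: "i \<in> (\<Union>k\<in>{1..j}. B k)" if i: "i \<in> (u W - u W') \<union> (u W' - u W)" for i
    proof -
      obtain k where k: "i \<in> B k" "k \<in> {1..d}" "k \<in> W \<longleftrightarrow> k \<notin> W'"
        using i W unfolding u_def by blast
      then have "k \<le> j" using top[of k] by (meson linorder_not_less)
      then show ?thesis using k by auto
    qed
    have Bj: "B j \<subseteq> u W' - u W"
      using dis[OF _ _ _ jd] j W unfolding u_def by blast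
    \<comment> \<open>All differing coordinates lie in the first \<open>j\<close> blocks, so the
      last coordinate \<open>t\<close> of these blocks is the most significant one that
      differs.\<close>
    obtain t where t: "t \<in> B j" "\<And>k s. k \<in> {1..j} \<Longrightarrow> s \<in> B k \<Longrightarrow> s \<le> t"
      using bspec[OF B3 jd] by blast
    have same: "i \<in> u W \<longleftrightarrow> i \<in> u W'" if "t < i" for i
    proof (rule ccontr)
      assume "\<not> ?thesis"
      then obtain k where "k \<in> {1..j}" "i \<in> B k" using diff[of i] by blast
      then show False using t(2) that by fastforce
    qed
    show "q (u W) < q (u W')"
      unfolding q_def
      by (rule grid_point_less[OF h, where t = t]) (use w t(1) Bj Bn[OF jd] same in auto)
    have "(u W - u W') \<union> (u W' - u W) \<subseteq> (\<Union>k\<in>{1..j}. B k)"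
      using diff by (rule subsetI)
    moreover have "(u W - u W') \<inter> (u W' - u W) = {}" by blast
    ultimately have "Pos (u W - u W') (u W' - u W)"
      using bspec[OF B4 jd] Bj by simp
    then show "R (q (u W)) (q (u W'))"
      unfolding q_def using un W by (intro R) auto
  qed
  have trichotomy: "(q (u W) < q (u W') \<and> R (q (u W)) (q (u W'))) \<or>
      (q (u W') < q (u W) \<and> R (q (u W')) (q (u W)))"
    if W: "W \<subseteq> {1..d}" "W' \<subseteq> {1..d}" and neq: "W \<noteq> W'" for W W'
  proof -
    \<comment> \<open>The largest element of the symmetric difference lies in exactly one of the two
      sets, and that set gives the larger point.\<close>
    let ?D = "(W - W') \<union> (W' - W)"
    have fin: "finite ?D" using W by (meson finite_Diff finite_UnI finite_atLeastAtMost finite_subset)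
    have D: "Max ?D \<in> ?D" using neq fin by (intro Max_in) auto
    have top: "k \<in> W \<longleftrightarrow> k \<in> W'" if "Max ?D < k" for k
      using Max_ge[OF fin, of k] that by fastforce
    show ?thesis
      using D less[of W W' "Max ?D"] less[of W' W "Max ?D"] W top by blast
  qed
  let ?S = "(\<lambda>W. q (u W)) ` Pow {1..d}"
  have inj: "inj_on (\<lambda>W. q (u W)) (Pow {1..d})"
    by (rule inj_onI) (use trichotomy in \<open>metis PowD nat_neq_iff\<close>)
  have card: "card (int ` ?S) = 2 ^ d"
    using inj by (simp add: card_image card_Pow)
  \<comment> \<open>\<open>\<delta> i\<close> is the gain from switching digit \<open>i\<close> from
    0 to 1. A direction of the cube is the total gain over one block; the base point has all digits
    0.\<close>
  define \<delta> where "\<delta> = (\<lambda>i. (2::int) ^ h (w * i + 1) - 2 ^ h (w * i))"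
  define x where "x = (\<lambda>k. if k = 0 then int (q {}) else (\<Sum>i\<in>B k. \<delta> i))"
  have q_u: "int (q (u W)) = x 0 + (\<Sum>k\<in>W. x k)" if W: "W \<subseteq> {1..d}" for W
  proof -
    have fB: "finite (B k)" if "k \<in> W" for k
      using Bn that W by (meson finite_lessThan finite_subset subsetD)
    have fW: "finite W" using W finite_subset by blast
    have "int (q (u W)) = (\<Sum>i<n. 2 ^ h (w * i) + (if i \<in> u W then \<delta> i else 0))"
      unfolding q_def grid_point_def by (auto simp: \<delta>_def intro!: sum.cong)
    also have "\<dots> = x 0 + (\<Sum>i\<in>u W. \<delta> i)"
      using un[OF W] by (simp add: sum.distrib x_def q_def grid_point_def sum.If_cases Int_absorb1)
    also have "(\<Sum>i\<in>u W. \<delta> i) = (\<Sum>k\<in>W. \<Sum>i\<in>B k. \<delta> i)"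
      unfolding u_def by (rule sum.UNION_disjoint) (use fW fB dis W in blast)+
    also have "\<dots> = (\<Sum>k\<in>W. x k)"
      using W by (intro sum.cong) (auto simp: x_def)
    finally show ?thesis .
  qed
  have "int ` ?S = {x 0 + (\<Sum>i = 1..d. \<epsilon> i * x i) | \<epsilon>. \<forall>i\<in>{1..d}. \<epsilon> i \<in> {0, 1}}" (is "_ = ?C")
  proof (intro equalityI subsetI)
    fix z assume "z \<in> int ` ?S"
    then obtain W where W: "W \<subseteq> {1..d}" and z: "z = int (q (u W))" by auto
    have "(\<Sum>k\<in>W. x k) = (\<Sum>k=1..d. of_bool (k \<in> W) * x k)"
      using W by (simp add: of_bool_def if_distrib[of "\<lambda>c. c * _"] sum.If_cases Int_absorb1 cong: if_cong)
    then have "z = x 0 + (\<Sum>k=1..d. of_bool (k \<in> W) * x k)"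
      using z q_u[OF W] by simp
    then show "z \<in> ?C"
      unfolding mem_Collect_eq by (intro exI[of _ "\<lambda>k. of_bool (k \<in> W)"]) auto
  next
    fix z assume "z \<in> ?C"
    then obtain \<epsilon> where z: "z = x 0 + (\<Sum>i = 1..d. \<epsilon> i * x i)"
      and \<epsilon>: "\<And>i. i \<in> {1..d} \<Longrightarrow> \<epsilon> i \<in> {0, 1}" by auto
    let ?W = "{k \<in> {1..d}. \<epsilon> k = 1}"
    have "(\<Sum>i = 1..d. \<epsilon> i * x i) = (\<Sum>i = 1..d. if \<epsilon> i = 1 then x i else 0)"
      using \<epsilon> by (intro sum.cong) fastforce+
    also have "\<dots> = (\<Sum>k\<in>?W. x k)"
      by (simp only: sum.inter_filter finite_atLeastAtMost)
    finally have sum: "(\<Sum>i = 1..d. \<epsilon> i * x i) = (\<Sum>k\<in>?W. x k)" .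
    have W: "?W \<subseteq> {1..d}" by blast
    have "z = int (q (u ?W))"
      unfolding q_u[OF W] z sum ..
    then show "z \<in> int ` ?S"
      using W by (intro image_eqI[of _ int "q (u ?W)"] imageI PowI)
  qed
  then have "affine_cube d (int ` ?S)"
    unfolding affine_cube_def by (rule exI[of _ x])
  with card have cube: "proper_affine_cube d (int ` ?S)"
    unfolding proper_affine_cube_def by (intro conjI)
  have sub: "?S \<subseteq> (\<lambda>X. grid_point w n h (ind X)) ` Pow {..<n}"
    unfolding q_def using un by (intro image_subsetI imageI PowI) (simp add: Pow_def)
  have ord: "R s s'" if s: "s \<in> ?S" "s' \<in> ?S" "s < s'" for s s'
  proof -
    obtain W W' where W: "W \<subseteq> {1..d}" "W' \<subseteq> {1..d}" and eq: "s = q (u W)" "s' = q (u W')"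
      using s by blast
    then have "W \<noteq> W'" using s(3) by auto
    from trichotomy[OF W this] s(3) show ?thesis
      unfolding eq by (elim disjE conjE) simp_all
  qed
  show ?thesis
    using cube sub by (intro exI[of _ ?S] conjI ballI impI ord)
qed

section \<open>From the Ramsey colour to sign patterns\<close>

text \<open>Keeping two digits per coordinate selects \<open>2 * n\<close> of the
  \<open>w * n\<close> positions. Grid points using only these digits become 0-1 points of a grid of
  width 2, the only points that the Ramsey colour sees.\<close>

lemma doubled_grid_point:
  assumes lu: "\<And>i. i < n \<Longrightarrow> l i < u i" "\<And>i. i < n \<Longrightarrow> u i < w"
  obtains e where "strict_mono_on {..<2 * n} e" "e ` {..<2 * n} \<subseteq> {..<w * n}"
    "\<And>x U. (\<And>i. i < n \<Longrightarrow> x i = (if i \<in> U then u i else l i)) \<Longrightarrow>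
      grid_point 2 n ((!) (map (h \<circ> e) [0..<2 * n])) (ind U) = grid_point w n h x"
proof
  \<comment> \<open>Positions \<open>2 * i\<close> and \<open>2 * i + 1\<close> stand for the lower
    and the upper digit of coordinate \<open>i\<close>.\<close>
  define e where "e = (\<lambda>k. w * (k div 2) + (if even k then l (k div 2) else u (k div 2)))"
  show "strict_mono_on {..<2 * n} e"
  proof (rule strict_mono_onI)
    fix k k' assume k: "k \<in> {..<2 * n}" "k' \<in> {..<2 * n}" "k < k'"
    show "e k < e k'"
    proof (cases "k div 2 = k' div 2")
      case True
      then have "even k" "odd k'" using k(3) by presburger+
      then show ?thesis using True lu(1)[of "k' div 2"] k by (simp add: e_def)
    next
      case False
      then have "k div 2 < k' div 2" using k(3) by linarith
      moreover have "l (k div 2) < w" "u (k div 2) < w"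
        using lu[of "k div 2"] k order_less_trans by (force, simp)
      ultimately show ?thesis
        unfolding e_def by (intro block_less) auto
    qed
  qed
  show "e ` {..<2 * n} \<subseteq> {..<w * n}"
  proof
    fix z assume "z \<in> e ` {..<2 * n}"
    then obtain k where k: "k < 2 * n" "z = e k" by auto
    have "e k < w * n + 0"
      unfolding e_def using k lu[of "k div 2"] by (intro block_less) auto
    then show "z \<in> {..<w * n}" using k by simp
  qed
  show "grid_point 2 n ((!) (map (h \<circ> e) [0..<2 * n])) (ind U) = grid_point w n h x"
    if "\<And>i. i < n \<Longrightarrow> x i = (if i \<in> U then u i else l i)" for x U
    unfolding grid_point_def using that by (intro sum.cong) (auto simp: e_def)
qed

text \<open>The list \<open>ys\<close> is read as a low and a high exponent for each coordinate, and
  the colour records how \<open>a\<close> compares all \<open>2 ^ n\<close> corners of this box. As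
  a relation on subsets of \<open>{..<n}\<close> it takes finitely many values.\<close>

definition sign_type :: "nat \<Rightarrow> (nat \<Rightarrow> real) \<Rightarrow> nat list \<Rightarrow> (nat set \<times> nat set) set" where
  "sign_type n a ys = {(U, V). U \<subseteq> {..<n} \<and> V \<subseteq> {..<n} \<and>
     a (grid_point 2 n ((!) ys) (ind U)) < a (grid_point 2 n ((!) ys) (ind V))}"

text \<open>Any two points are corners of a common box, whose type is the constant \<open>c\<close>.
  Which corners they are depends only on where one point exceeds the other.\<close>

lemma less_iff_sign_type:
  assumes c: "\<And>e. strict_mono_on {..<2 * n} e \<Longrightarrow> e ` {..<2 * n} \<subseteq> {..<w * n} \<Longrightarrow>
      sign_type n a (map (h \<circ> e) [0..<2 * n]) = c"
    and x: "\<And>i. i < n \<Longrightarrow> Suc (x i) < w" and y: "\<And>i. i < n \<Longrightarrow> Suc (y i) < w"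
  shows "a (grid_point w n h x) < a (grid_point w n h y) \<longleftrightarrow>
    ({i. i < n \<and> y i < x i}, {i. i < n \<and> x i < y i}) \<in> c"
proof -
  let ?l = "\<lambda>i. min (x i) (y i)"
  \<comment> \<open>Where the points agree, both take the lower digit and the upper one is a dummy;
    the bounds on \<open>Suc (x i)\<close> and \<open>Suc (y i)\<close> leave room for it.\<close>
  let ?u = "\<lambda>i. if x i = y i then Suc (x i) else max (x i) (y i)"
  let ?U = "{i. i < n \<and> y i < x i}"
  let ?V = "{i. i < n \<and> x i < y i}"
  have lu: "?l i < ?u i" "?u i < w" if "i < n" for i
    using x[OF that] y[OF that] by auto
  obtain e where e: "strict_mono_on {..<2 * n} e" "e ` {..<2 * n} \<subseteq> {..<w * n}"
    and gp: "\<And>z U. (\<And>i. i < n \<Longrightarrow> z i = (if i \<in> U then ?u i else ?l i)) \<Longrightarrow>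
      grid_point 2 n ((!) (map (h \<circ> e) [0..<2 * n])) (ind U) = grid_point w n h z"
    using doubled_grid_point[of n ?l ?u w h] lu by blast
  have "grid_point 2 n ((!) (map (h \<circ> e) [0..<2 * n])) (ind ?U) = grid_point w n h x"
    by (rule gp) auto
  moreover have "grid_point 2 n ((!) (map (h \<circ> e) [0..<2 * n])) (ind ?V) = grid_point w n h y"
    by (rule gp) auto
  ultimately show ?thesis
    unfolding c[OF e, symmetric] sign_type_def by auto
qed

text \<open>Totality comes from injectivity of \<open>a\<close>, composition from transitivity of
  the order of its values, both at suitable digits. Digits up to 4 occur and one more must be spare,
  hence width 6.\<close>

lemma sign_cone_sign_type:
  assumes h: "strict_mono_on {..<6 * n} h"
    and c: "\<And>e. strict_mono_on {..<2 * n} e \<Longrightarrow> e ` {..<2 * n} \<subseteq> {..<6 * n} \<Longrightarrow>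
      sign_type n a (map (h \<circ> e) [0..<2 * n]) = c"
    and inj: "inj_on a A" and A: "\<And>x. (\<And>i. i < n \<Longrightarrow> x i < 6) \<Longrightarrow> grid_point 6 n h x \<in> A"
  shows "sign_cone n (\<lambda>L G. (L, G) \<in> c)"
proof -
  let ?q = "grid_point 6 n h"
  have iff: "(L, G) \<in> c \<longleftrightarrow> a (?q x) < a (?q y)"
    if "\<And>i. i < n \<Longrightarrow> x i < 5" "\<And>i. i < n \<Longrightarrow> y i < 5"
      "\<And>i. i \<in> L \<longleftrightarrow> i < n \<and> y i < x i" "\<And>i. i \<in> G \<longleftrightarrow> i < n \<and> x i < y i" for x y L G
  proof -
    have "L = {i. i < n \<and> y i < x i}" "G = {i. i < n \<and> x i < y i}" using that by auto
    then show ?thesis using less_iff_sign_type[OF c, of 6 x y] that by simp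
  qed
  show ?thesis
  proof
    fix L G :: "nat set"
    assume LG: "L \<subseteq> {..<n}" "G \<subseteq> {..<n}" "L \<inter> G = {}" "L \<union> G \<noteq> {}"
    have "?q (ind L) \<noteq> ?q (ind G)"
      by (rule grid_point_inj[OF h]) (use LG in auto)
    then have "a (?q (ind L)) \<noteq> a (?q (ind G))"
      using inj A[of "ind L"] A[of "ind G"] by (auto dest: inj_onD)
    moreover have "(L, G) \<in> c \<longleftrightarrow> a (?q (ind L)) < a (?q (ind G))"
      by (rule iff) (use LG in auto)
    moreover have "(G, L) \<in> c \<longleftrightarrow> a (?q (ind G)) < a (?q (ind L))"
      by (rule iff) (use LG in auto)
    ultimately show "(L, G) \<in> c \<or> (G, L) \<in> c" by linarith
  next
    fix L G L' G' L'' G'' :: "nat set"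
    assume pos: "(L, G) \<in> c" "(L', G') \<in> c"
      and d: "L \<inter> G = {}" "L' \<inter> G' = {}" "L'' \<inter> G'' = {}" and n: "L \<union> G \<union> L' \<union> G' \<subseteq> {..<n}"
      and sub: "L'' \<subseteq> L \<union> L'" "G'' \<subseteq> G \<union> G'" "L - G' \<subseteq> L''" "L' - G \<subseteq> L''" "G - L' \<subseteq> G''" "G' - L \<subseteq> G''"
    \<comment> \<open>The two patterns are realised by moving from \<open>x\<close> to the constant
      2 and on to \<open>z\<close>. A coordinate that turns back starts and ends on the same side of
      2, where distances 1 and 2 produce the net sign prescribed by \<open>L''\<close> and
      \<open>G''\<close>.\<close>
    define x :: "nat \<Rightarrow> nat" where "x = (\<lambda>i. if i \<in> L then if i \<in> L'' then 4 else 3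
      else if i \<in> G then if i \<in> G'' then 0 else 1 else 2)"
    define z :: "nat \<Rightarrow> nat" where "z = (\<lambda>i. if i \<in> G' then if i \<in> G'' then 4 else 3
      else if i \<in> L' then if i \<in> L'' then 0 else 1 else 2)"
    have "a (?q x) < a (?q (\<lambda>_. 2))"
      by (subst iff[of x "\<lambda>_. 2" L G, symmetric]) (use pos d n in \<open>auto simp: x_def\<close>)
    also have "\<dots> < a (?q z)"
      by (subst iff[of "\<lambda>_. 2" z L' G', symmetric]) (use pos d n in \<open>auto simp: z_def\<close>)
    finally have less: "a (?q x) < a (?q z)" .
    have diff: "(i \<in> L'' \<longleftrightarrow> i < n \<and> z i < x i) \<and> (i \<in> G'' \<longleftrightarrow> i < n \<and> x i < z i)" for i
    proof -
      have "i \<in> L \<longrightarrow> i \<notin> G" "i \<in> L' \<longrightarrow> i \<notin> G'" "i \<in> L'' \<longrightarrow> i \<notin> G''"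
        "i \<in> L \<or> i \<in> G \<or> i \<in> L' \<or> i \<in> G' \<longrightarrow> i < n"
        "i \<in> L'' \<longrightarrow> i \<in> L \<or> i \<in> L'" "i \<in> G'' \<longrightarrow> i \<in> G \<or> i \<in> G'"
        "i \<in> L \<longrightarrow> i \<notin> G' \<longrightarrow> i \<in> L''" "i \<in> L' \<longrightarrow> i \<notin> G \<longrightarrow> i \<in> L''"
        "i \<in> G \<longrightarrow> i \<notin> L' \<longrightarrow> i \<in> G''" "i \<in> G' \<longrightarrow> i \<notin> L \<longrightarrow> i \<in> G''"
        using d n sub by blast+
      then show ?thesis
        unfolding x_def z_def
        by (cases "i \<in> L"; cases "i \<in> G"; cases "i \<in> L'"; cases "i \<in> G'";
            cases "i \<in> L''"; cases "i \<in> G''") simp_all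
    qed
    have "x i < 5" "z i < 5" for i
      by (simp_all add: x_def z_def)
    then show "(L'', G'') \<in> c"
      using less iff[of x z L'' G''] diff by blast
  qed
qed

section \<open>Bound on the length and choice of the direction\<close>

theorem theorem1:
  fixes d :: nat
  assumes "d > 0"
  shows "\<exists>m > 0. \<forall>a :: nat \<Rightarrow> real. inj_on a {1..m} \<longrightarrow>
           (\<exists>S \<subseteq> {1..m}. proper_affine_cube d (int ` S) \<and>
              (mono_on S a \<or> antimono_on S a))"
proof -
  define n where "n = 4 * d"
  have n: "n > 0" using assms by (simp add: n_def)
  let ?C = "Pow (Pow {..<n} \<times> Pow {..<n})"
  have "finite ?C" by simp
  then obtain N where N: "\<And>F. range F \<subseteq> ?C \<Longrightarrow>
    \<exists>h c. strict_mono_on {..<6 * n} h \<and> h ` {..<6 * n} \<subseteq> {..<N::nat} \<and>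
      (\<forall>e. strict_mono_on {..<2 * n} e \<and> e ` {..<2 * n} \<subseteq> {..<6 * n} \<longrightarrow>
         F (map (h \<circ> e) [0..<2 * n]) = c)"
    using ramsey_enumeration[of ?C "6 * n" "2 * n"] by blast
  show ?thesis
  \<comment> \<open>A grid point is a sum of \<open>n > 0\<close> powers of 2 with exponents below
    \<open>N\<close>, so it lies between 1 and \<open>n * 2 ^ N\<close>.\<close>
  proof (intro exI[of _ "n * 2 ^ N"] conjI allI impI)
    show "n * 2 ^ N > 0" using n by simp
    fix a :: "nat \<Rightarrow> real" assume inj: "inj_on a {1..n * 2 ^ N}"
    have "range (sign_type n a) \<subseteq> ?C" by (auto simp: sign_type_def)
    from N[OF this] obtain h c where h: "strict_mono_on {..<6 * n} h" and hN: "h ` {..<6 * n} \<subseteq> {..<N}"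
      and c': "\<forall>e. strict_mono_on {..<2 * n} e \<and> e ` {..<2 * n} \<subseteq> {..<6 * n} \<longrightarrow>
        sign_type n a (map (h \<circ> e) [0..<2 * n]) = c"
      by (elim exE conjE)
    have c: "sign_type n a (map (h \<circ> e) [0..<2 * n]) = c"
      if "strict_mono_on {..<2 * n} e" "e ` {..<2 * n} \<subseteq> {..<6 * n}" for e
      using c' that by simp
    let ?q = "grid_point 6 n h"
    have q: "?q x \<in> {1..n * 2 ^ N}" if "\<And>i. i < n \<Longrightarrow> x i < 6" for x
    proof -
      have "(2::nat) ^ h (6 * i + x i) \<le> 2 ^ N" if "i < n" for i
        using hN block_less[of i n "x i" 6 0] that \<open>\<And>i. i < n \<Longrightarrow> x i < 6\<close>
        by (intro power_increasing) (auto simp: image_subset_iff less_imp_le)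
      then have "?q x \<le> n * 2 ^ N"
        unfolding grid_point_def
        using sum_bounded_above[of "{..<n}" "\<lambda>i. 2 ^ h (6 * i + x i)" "2 ^ N :: nat"] by simp
      moreover have "?q x > 0"
        unfolding grid_point_def using n by (intro sum_pos) auto
      ultimately show ?thesis by simp
    qed
    have points: "(\<lambda>X. ?q (ind X)) ` Pow {..<n} \<subseteq> {1..n * 2 ^ N}"
      by (intro image_subsetI q) simp
    interpret sign_cone n "\<lambda>L G. (L, G) \<in> c"
      using h c inj q by (rule sign_cone_sign_type)
    have less: "a (?q (ind X)) < a (?q (ind Y))"
      if "X \<subseteq> {..<n}" "Y \<subseteq> {..<n}" "(X - Y, Y - X) \<in> c" for X Y
    proof -
      have "X - Y = {i. i < n \<and> ind Y i < ind X i}" "Y - X = {i. i < n \<and> ind X i < ind Y i}"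
        using that by auto
      then show ?thesis
        using less_iff_sign_type[OF c, of 6 "ind X" "ind Y"] that(3) by simp
    qed
    \<comment> \<open>Raising a coordinate of \<open>E\<close> alone raises \<open>a\<close>, and so
      does lowering one of \<open>E'\<close>. By totality the two sets cover all
      \<open>4 * d\<close> coordinates, so one has at least \<open>2 * d\<close> elements.\<close>
    define E where "E = {i. i < n \<and> ({}, {i}) \<in> c}"
    define E' where "E' = {i. i < n \<and> ({i}, {}) \<in> c}"
    have "{..<n} \<subseteq> E \<union> E'"
    proof
      fix i assume "i \<in> {..<n}"
      then show "i \<in> E \<union> E'"
        using total[of "{}" "{i}"] by (simp add: E_def E'_def)
    qed
    moreover have "finite (E \<union> E')"
      by (simp add: E_def E'_def)
    ultimately have "card {..<n} \<le> card (E \<union> E')"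
      by (intro card_mono)
    then have "2 * d \<le> card E \<or> 2 * d \<le> card E'"
      using card_Un_le[of E E'] unfolding card_lessThan n_def by linarith
    then show "\<exists>S \<subseteq> {1..n * 2 ^ N}. proper_affine_cube d (int ` S) \<and> (mono_on S a \<or> antimono_on S a)"
    proof
      assume "2 * d \<le> card E"
      moreover have "E \<subseteq> {..<n}" "\<And>i. i \<in> E \<Longrightarrow> ({}, {i}) \<in> c"
        by (auto simp: E_def)
      ultimately obtain S where S: "S \<subseteq> (\<lambda>X. ?q (ind X)) ` Pow {..<n}" "proper_affine_cube d (int ` S)"
        "\<And>s s'. s \<in> S \<Longrightarrow> s' \<in> S \<Longrightarrow> s < s' \<Longrightarrow> a s < a s'"
        using ex_ordered_cube[OF h, of "\<lambda>s s'. a s < a s'" E d] less by auto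
      have "mono_on S a"
        using S(3) by (auto intro!: mono_onI simp: le_less)
      moreover have "S \<subseteq> {1..n * 2 ^ N}"
        using S(1) points by (rule subset_trans)
      ultimately show ?thesis using S(2) by blast
    next
      \<comment> \<open>With the arguments swapped, raising a coordinate of \<open>E'\<close> counts
        as positive, and the values decrease along the cube.\<close>
      interpret op: sign_cone n "\<lambda>L G. (G, L) \<in> c"
        by (rule dual)
      assume "2 * d \<le> card E'"
      moreover have "E' \<subseteq> {..<n}" "\<And>i. i \<in> E' \<Longrightarrow> ({i}, {}) \<in> c"
        by (auto simp: E'_def)
      ultimately obtain S where S: "S \<subseteq> (\<lambda>X. ?q (ind X)) ` Pow {..<n}" "proper_affine_cube d (int ` S)"
        "\<And>s s'. s \<in> S \<Longrightarrow> s' \<in> S \<Longrightarrow> s < s' \<Longrightarrow> a s' < a s"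
        using op.ex_ordered_cube[OF h, of "\<lambda>s s'. a s' < a s" E' d] less by auto
      have "antimono_on S a"
        using S(3) by (auto intro!: monotone_onI simp: le_less)
      moreover have "S \<subseteq> {1..n * 2 ^ N}"
        using S(1) points by (rule subset_trans)
      ultimately show ?thesis using S(2) by blast
    qed
  qed
qed

end
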